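(* Let $K\ge 0$ be an integer. Let $G_1,\ldots,G_n$ be nondeterministic automata, where $G_i$ has set of secret states $Q_i^S$, and consider the composed system $G_1\|\cdots\|G_n$ with interaction $\|_\lor$, i.e. with set of secret states $Q^S=Q\setminus(Q_1^{NS}\times\cdots\times Q_n^{NS})$, $Q_i^{NS}=Q_i\setminus Q_i^S$. Let $\sim$ be an opaque observation equivalence on $G_1$ and $\tilde G_1$ the quotient automaton of $G_1$ modulo $\sim$. Then $G_1\|\cdots\|G_n$ is $K$-step opaque if and only if $\tilde G_1\|G_2\|\cdots\|G_n$ is $K$-step opaque (with secret states defined in the same $\|_\lor$ manner).
   Context: An automaton is $G=\langle\Sigma_\tau,Q,\to,Q^\circ\rangle$ with finite set $\Sigma$ of observable events, a special unobservable event $\tau\notin\Sigma$, $\Sigma_\tau=\Sigma\cup\{\tau\}$, finite states $Q$, transitions $\to\subseteq Q\times\Sigma_\tau\times Q$, initial states $Q^\circ$; it carries secret states $Q^S\subseteq Q$ and $Q^{NS}=Q\setminus Q^S$. For $s\in\Sigma^*$, $p\stackrel{s}{\Rightarrow}q$ means there is $t\in\Sigma_\tau^*$ which becomes $s$ after deleting all $\tau$'s and $p\stackrel{t}{\to}q$; $p\stackrel{s}{\Rightarrow}$ means this for some $q$; $L(G,q)=\{s\in\Sigma^*:q\stackrel{s}{\Rightarrow}\}$. Synchronous composition: states are tuples, initial states products of initial states; an event in $\Sigma$ shared by components is executed jointly by all components having it in their alphabet; other events (including $\tau$, never shared) are executed by a single component while the others stay put. $K$-step opacity: $G$ is $K$-step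 opaque w.r.t. $Q^S$ iff for every $q^\circ\in Q^\circ$ and all $s,t\in\Sigma^*$ with $st\in L(G,q^\circ)$, $q^\circ\stackrel{s}{\Rightarrow}Q^S$ and $|t|\le K$, there exist $q'^\circ\in Q^\circ$ and $y\in Q^{NS}$ with $q'^\circ\stackrel{s}{\Rightarrow}y$ and $y\stackrel{t}{\Rightarrow}$. Opaque observation equivalence: an equivalence relation $\sim$ on $Q$ such that whenever $x_1\sim x_2$: (i) if $x_1\stackrel{s}{\Rightarrow}y_1$ for some $s\in\Sigma^*$, then there is $y_2$ with $x_2\stackrel{s}{\Rightarrow}y_2$ and $y_1\sim y_2$; (ii) $x_1\in Q^S$ iff $x_2\in Q^S$. Quotient automaton modulo $\sim$: states are the classes $[x]$, $([x],\sigma,[y])$ is a transition iff $x'\stackrel{\sigma}{\to}y'$ for some $x'\in[x]$, $y'\in[y]$, initial states $\{[x^\circ]:x^\circ\in Q^\circ\}$; a class $[x]$ is secret iff $x\in Q^S$. *)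

theory Defs
  imports Main
begin

text \<open>
  Observable events are \<open>Some \<sigma>\<close> with \<open>\<sigma>\<close> in the alphabet; the unobservable event \<open>\<tau>\<close> is \<open>None\<close>,
  so it never belongs to an alphabet.
\<close>

record ('e, 'q) automaton =
  alphabet :: "'e set"
  states :: "'q set"
  transitions :: "('q \<times> 'e option \<times> 'q) set"
  initial :: "'q set"
  secret :: "'q set"

definition events_tau :: "('e, 'q) automaton \<Rightarrow> 'e option set" where
  "events_tau G = insert None (Some ` alphabet G)"

definition wf_automaton :: "('e, 'q) automaton \<Rightarrow> bool" where
  "wf_automaton G \<longleftrightarrow>
     finite (alphabet G) \<and> finite (states G) \<and>
     transitions G \<subseteq> states G \<times> events_tau G \<times> states G \<and>
     initial G \<subseteq> states G \<and> secret G \<subseteq> states G"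

definition nonsecret :: "('e, 'q) automaton \<Rightarrow> 'q set" where
  "nonsecret G = states G - secret G"

fun path :: "('e, 'q) automaton \<Rightarrow> 'q \<Rightarrow> 'e option list \<Rightarrow> 'q \<Rightarrow> bool" where
  "path G p [] q \<longleftrightarrow> p = q"
| "path G p (e # t) q \<longleftrightarrow> (\<exists>r. (p, e, r) \<in> transitions G \<and> path G r t q)"

definition delete_tau :: "'e option list \<Rightarrow> 'e list" where
  "delete_tau t = map the (filter (\<lambda>e. e \<noteq> None) t)"

definition weak_path :: "('e, 'q) automaton \<Rightarrow> 'q \<Rightarrow> 'e list \<Rightarrow> 'q \<Rightarrow> bool" where
  "weak_path G p s q \<longleftrightarrow> (\<exists>t \<in> lists (events_tau G). delete_tau t = s \<and> path G p t q)"

definition language :: "('e, 'q) automaton \<Rightarrow> 'q \<Rightarrow> 'e list set" where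
  "language G q = {s \<in> lists (alphabet G). \<exists>r. weak_path G q s r}"

definition K_step_opaque :: "nat \<Rightarrow> ('e, 'q) automaton \<Rightarrow> bool" where
  "K_step_opaque K G \<longleftrightarrow>
     (\<forall>q0 \<in> initial G. \<forall>s \<in> lists (alphabet G). \<forall>t \<in> lists (alphabet G).
        s @ t \<in> language G q0 \<and> (\<exists>x \<in> secret G. weak_path G q0 s x) \<and> length t \<le> K \<longrightarrow>
        (\<exists>q0' \<in> initial G. \<exists>y \<in> nonsecret G. weak_path G q0' s y \<and> (\<exists>z. weak_path G y t z)))"

definition opaque_observation_equivalence :: "('e, 'q) automaton \<Rightarrow> ('q \<times> 'q) set \<Rightarrow> bool" where
  "opaque_observation_equivalence G R \<longleftrightarrow>
     equiv (states G) R \<and>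
     (\<forall>(x1, x2) \<in> R.
        (\<forall>s \<in> lists (alphabet G). \<forall>y1. weak_path G x1 s y1 \<longrightarrow>
           (\<exists>y2. weak_path G x2 s y2 \<and> (y1, y2) \<in> R)) \<and>
        (x1 \<in> secret G \<longleftrightarrow> x2 \<in> secret G))"

definition quotient_automaton ::
    "('e, 'q) automaton \<Rightarrow> ('q \<times> 'q) set \<Rightarrow> ('e, 'q set) automaton" where
  "quotient_automaton G R =
     \<lparr>alphabet = alphabet G,
      states = states G // R,
      transitions = {(X, e, Y). X \<in> states G // R \<and> Y \<in> states G // R \<and>
                       (\<exists>x \<in> X. \<exists>y \<in> Y. (x, e, y) \<in> transitions G)},
      initial = {R `` {x} |x. x \<in> initial G},
      secret = {R `` {x} |x. x \<in> secret G}\<rparr>"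

text \<open>
  The part of one component in the execution of the observable event \<open>\<sigma>\<close> by the composed system.
\<close>

definition local_step :: "('e, 'q) automaton \<Rightarrow> 'e \<Rightarrow> 'q \<Rightarrow> 'q \<Rightarrow> bool" where
  "local_step G \<sigma> x y \<longleftrightarrow>
     (if \<sigma> \<in> alphabet G then (x, Some \<sigma>, y) \<in> transitions G else y = x)"

text \<open>
  \<open>sync_or G [H\<^sub>2, \<dots>, H\<^sub>n]\<close> is the synchronous composition of \<open>G, H\<^sub>2, \<dots>, H\<^sub>n\<close>, whose secret states are
  the tuples with at least one secret component. A tuple \<open>(x\<^sub>1, \<dots>, x\<^sub>n)\<close> is encoded as
  \<open>(x\<^sub>1, [x\<^sub>2, \<dots>, x\<^sub>n])\<close>: the first component has a state type of its own because passing to the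
  quotient changes its state type.
\<close>

definition sync_or ::
    "('e, 'p) automaton \<Rightarrow> ('e, 'q) automaton list \<Rightarrow> ('e, 'p \<times> 'q list) automaton" where
  "sync_or G Hs =
     (let Q = states G \<times> listset (map states Hs);
          A = alphabet G \<union> (\<Union>H \<in> set Hs. alphabet H) in
      \<lparr>alphabet = A,
       states = Q,
       transitions =
         {((x, xs), Some \<sigma>, (y, ys)) |x xs \<sigma> y ys.
            (x, xs) \<in> Q \<and> (y, ys) \<in> Q \<and> \<sigma> \<in> A \<and> local_step G \<sigma> x y \<and>
            (\<forall>i < length Hs. local_step (Hs ! i) \<sigma> (xs ! i) (ys ! i))} \<union>
         {((x, xs), None, (y, xs)) |x xs y.
            (x, xs) \<in> Q \<and> (x, None, y) \<in> transitions G} \<union>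
         {((x, xs), None, (x, xs[i := y])) |x xs i y.
            (x, xs) \<in> Q \<and> i < length Hs \<and> (xs ! i, None, y) \<in> transitions (Hs ! i)},
       initial = initial G \<times> listset (map initial Hs),
       secret = Q - nonsecret G \<times> listset (map nonsecret Hs)\<rparr>)"

end

theory Submission
  imports Defs
begin

text \<open>
  The relation between \<open>x\<close> and its class \<open>[x]\<close> is a weak bisimulation between \<open>G\<^sub>1\<close> and its quotient
  that respects secrets. Weak bisimulations are preserved by synchronous composition, since a
  \<open>\<tau>\<close>-step of one component leaves the others untouched and may be inserted around a joint step;
  and \<open>K\<close>-step opacity is invariant under secret-respecting weak bisimulations.
\<close>

section \<open>Weak paths, weak simulations and the invariance of K-step opacity\<close>

definition weak_simulation ::
    "('e, 'p) automaton \<Rightarrow> ('e, 'q) automaton \<Rightarrow> ('p \<times> 'q) set \<Rightarrow> bool" where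
  "weak_simulation A B S \<longleftrightarrow>
     (\<forall>p q e p'. (p, q) \<in> S \<longrightarrow> (p, e, p') \<in> transitions A \<longrightarrow>
        (\<exists>q'. weak_path B q (delete_tau [e]) q' \<and> (p', q') \<in> S))"

lemma delete_tau_simps [simp]:
  "delete_tau [] = []"
  "delete_tau (None # t) = delete_tau t"
  "delete_tau (Some a # t) = a # delete_tau t"
  "delete_tau (t @ u) = delete_tau t @ delete_tau u"
  by (simp_all add: delete_tau_def)

lemma delete_tau_Cons: "delete_tau (e # t) = delete_tau [e] @ delete_tau t"
  by (cases e) simp_all

lemma path_append: "path G p (t @ u) q \<longleftrightarrow> (\<exists>r. path G p t r \<and> path G r u q)"
  by (induction t arbitrary: p) auto

lemma weak_path_refl: "weak_path G p [] p"
  unfolding weak_path_def by (intro bexI [of _ "[]"]) auto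

lemma weak_path_trans:
  assumes "weak_path G p s q" and "weak_path G q t r"
  shows "weak_path G p (s @ t) r"
proof -
  obtain u v where "u \<in> lists (events_tau G)" "delete_tau u = s" "path G p u q"
    and "v \<in> lists (events_tau G)" "delete_tau v = t" "path G q v r"
    using assms unfolding weak_path_def by blast
  then show ?thesis
    unfolding weak_path_def by (intro bexI [of _ "u @ v"]) (auto simp: path_append)
qed

lemma weak_path_step:
  assumes "(p, e, q) \<in> transitions G" and "e \<in> events_tau G"
  shows "weak_path G p (delete_tau [e]) q"
  unfolding weak_path_def using assms by (intro bexI [of _ "[e]"]) auto

text \<open>Single matched transitions suffice: by induction along the path, each transition
  labelled \<open>e\<close> is replaced by a weak path observing \<open>delete_tau [e]\<close>,
  which is empty for \<tau>, and the pieces are concatenated.\<close>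

lemma weak_simulation_weak_path:
  assumes "weak_simulation A B S" and "(p, q) \<in> S" and "weak_path A p s p'"
  obtains q' where "weak_path B q s q'" and "(p', q') \<in> S"
proof -
  have sim: "path A p t p' \<Longrightarrow> (p, q) \<in> S \<Longrightarrow>
      \<exists>q'. weak_path B q (delete_tau t) q' \<and> (p', q') \<in> S" for t
  proof (induction t arbitrary: p q)
    case Nil
    then show ?case by (auto intro: weak_path_refl)
  next
    case (Cons e t)
    then obtain r where "(p, e, r) \<in> transitions A" "path A r t p'" by auto
    moreover from this obtain r' where r': "weak_path B q (delete_tau [e]) r'" "(r, r') \<in> S"
      using assms(1) Cons.prems(2) unfolding weak_simulation_def by blast
    ultimately obtain q' where "weak_path B r' (delete_tau t) q'" "(p', q') \<in> S"
      using Cons.IH by blast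
    with weak_path_trans [OF r'(1)] show ?case
      unfolding delete_tau_Cons [of e t] by blast
  qed
  from assms(3) obtain t where t: "delete_tau t = s" "path A p t p'"
    unfolding weak_path_def by blast
  from sim [OF t(2) assms(2)] show thesis
    unfolding t(1) using that by blast
qed

text \<open>A run of \<open>B\<close> is pulled back along \<open>BA\<close>, opacity of
  \<open>A\<close> supplies a nonsecret alternative, and this is pushed forward along
  \<open>AB\<close>. Hence secrecy is pulled back and nonsecrecy is pushed forward. The latter
  includes membership in \<open>states B\<close>.\<close>

lemma K_step_opaque_weak_bisimulation:
  assumes AB: "weak_simulation A B S" and BA: "weak_simulation B A (S\<inverse>)"
    and alphabet: "alphabet A = alphabet B"
    and initial_AB: "\<And>p. p \<in> initial A \<Longrightarrow> \<exists>q \<in> initial B. (p, q) \<in> S"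
    and initial_BA: "\<And>q. q \<in> initial B \<Longrightarrow> \<exists>p \<in> initial A. (p, q) \<in> S"
    and secret: "\<And>p q. (p, q) \<in> S \<Longrightarrow> q \<in> secret B \<Longrightarrow> p \<in> secret A"
    and nonsecret: "\<And>p q. (p, q) \<in> S \<Longrightarrow> p \<in> nonsecret A \<Longrightarrow> q \<in> nonsecret B"
    and opaque: "K_step_opaque K A"
  shows "K_step_opaque K B"
  unfolding K_step_opaque_def
proof (intro ballI impI, elim conjE bexE)
  fix q0 s t x
  assume q0: "q0 \<in> initial B" and st: "s \<in> lists (alphabet B)" "t \<in> lists (alphabet B)"
    and lang: "s @ t \<in> language B q0" and x: "x \<in> secret B" "weak_path B q0 s x"
    and len: "length t \<le> K"
  obtain p0 where p0: "p0 \<in> initial A" "(p0, q0) \<in> S"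
    using initial_BA q0 by blast
  then have inv: "(q0, p0) \<in> S\<inverse>" by simp
  obtain w where w: "weak_path A p0 s w" "(x, w) \<in> S\<inverse>"
    using weak_simulation_weak_path [OF BA inv x(2)] .
  then have "w \<in> secret A"
    using secret x(1) by simp
  \<comment> \<open>The run of \<open>s @ t\<close> and the run of \<open>s\<close> into a secret
    state need not share a prefix, so they are matched independently, but both from the same
    \<open>p0\<close>.\<close>
  moreover obtain v where "weak_path B q0 (s @ t) v"
    using lang unfolding language_def by blast
  then obtain v' where "weak_path A p0 (s @ t) v'"
    using weak_simulation_weak_path [OF BA inv] by blast
  then have "s @ t \<in> language A p0"
    using st alphabet by (auto simp: language_def)
  ultimately obtain p0' y z where "p0' \<in> initial A" and y: "y \<in> nonsecret A" "weak_path A p0' s y"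
    and z: "weak_path A y t z"
    using w(1) opaque p0(1) st len unfolding K_step_opaque_def alphabet by blast
  then obtain q0' where q0': "q0' \<in> initial B" "(p0', q0') \<in> S"
    using initial_AB by blast
  obtain y' where y': "weak_path B q0' s y'" "(y, y') \<in> S"
    using weak_simulation_weak_path [OF AB q0'(2) y(2)] .
  obtain z' where "weak_path B y' t z'"
    using weak_simulation_weak_path [OF AB y'(2) z] .
  then show "\<exists>q0' \<in> initial B. \<exists>y \<in> nonsecret B. weak_path B q0' s y \<and> (\<exists>z. weak_path B y t z)"
    using q0'(1) y' nonsecret y(1) by blast
qed

section \<open>Weak simulations under synchronous composition\<close>

lemma sync_or_sel:
  "alphabet (sync_or G Hs) = alphabet G \<union> (\<Union>H \<in> set Hs. alphabet H)"
  "states (sync_or G Hs) = states G \<times> listset (map states Hs)"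
  "initial (sync_or G Hs) = initial G \<times> listset (map initial Hs)"
  "secret (sync_or G Hs) = states G \<times> listset (map states Hs)
     - nonsecret G \<times> listset (map nonsecret Hs)"
  by (simp_all add: sync_or_def Let_def)

lemma sync_or_transition_cases:
  assumes "((x, xs), e, p') \<in> transitions (sync_or G Hs)"
  obtains (joint) \<sigma> y ys where "e = Some \<sigma>" "p' = (y, ys)" "xs \<in> listset (map states Hs)"
      "ys \<in> listset (map states Hs)" "\<sigma> \<in> alphabet (sync_or G Hs)" "local_step G \<sigma> x y"
      "\<forall>i < length Hs. local_step (Hs ! i) \<sigma> (xs ! i) (ys ! i)"
    | (left) y where "e = None" "p' = (y, xs)" "xs \<in> listset (map states Hs)"
      "(x, None, y) \<in> transitions G"
    | (right) i y where "e = None" "p' = (x, xs[i := y])" "xs \<in> listset (map states Hs)"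
      "i < length Hs" "(xs ! i, None, y) \<in> transitions (Hs ! i)"
  using assms by (auto simp: sync_or_def Let_def)

lemma sync_or_joint:
  assumes "x \<in> states G" "y \<in> states G"
    and "xs \<in> listset (map states Hs)" "ys \<in> listset (map states Hs)"
    and "\<sigma> \<in> alphabet (sync_or G Hs)" "local_step G \<sigma> x y"
    and "\<forall>i < length Hs. local_step (Hs ! i) \<sigma> (xs ! i) (ys ! i)"
  shows "((x, xs), Some \<sigma>, (y, ys)) \<in> transitions (sync_or G Hs)"
  using assms by (auto simp: sync_or_def Let_def)

lemma sync_or_left:
  assumes "x \<in> states G" "xs \<in> listset (map states Hs)" "(x, None, y) \<in> transitions G"
  shows "((x, xs), None, (y, xs)) \<in> transitions (sync_or G Hs)"
  using assms by (auto simp: sync_or_def Let_def)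

lemma sync_or_right:
  assumes "x \<in> states G" "xs \<in> listset (map states Hs)"
    and "i < length Hs" "(xs ! i, None, y) \<in> transitions (Hs ! i)"
  shows "((x, xs), None, (x, xs[i := y])) \<in> transitions (sync_or G Hs)"
  using assms by (auto simp: sync_or_def Let_def)

lemma wf_automaton_transition:
  assumes "wf_automaton G" "(x, e, y) \<in> transitions G"
  shows "x \<in> states G" "e \<in> events_tau G" "y \<in> states G"
  using assms unfolding wf_automaton_def by auto

text \<open>Every letter of \<open>t\<close> is \<tau>, so the first component moves alone and the
  other coordinates stay frozen at \<open>xs\<close>.\<close>

lemma sync_or_path_tau:
  assumes "wf_automaton G" and "xs \<in> listset (map states Hs)"
  shows "path G x t y \<Longrightarrow> delete_tau t = [] \<Longrightarrow> path (sync_or G Hs) (x, xs) t (y, xs)"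
proof (induction t arbitrary: x)
  case (Cons e t)
  then obtain z where "(x, None, z) \<in> transitions G" "path G z t y" "e = None" "delete_tau t = []"
    by (cases e) auto
  moreover from this have "((x, xs), None, (z, xs)) \<in> transitions (sync_or G Hs)"
    using sync_or_left wf_automaton_transition(1) assms by metis
  ultimately show ?case
    using Cons.IH by auto
qed simp

text \<open>The word \<open>t\<close> has the form \<tau>...\<tau> \<sigma> \<tau>...\<tau>. The
  leading \<tau>-steps are done at \<open>xs\<close>, the other components switch to
  \<open>ys\<close> exactly at \<sigma>, and the trailing \<tau>-steps are done at
  \<open>ys\<close>.\<close>

lemma sync_or_path_joint:
  assumes wf: "wf_automaton G"
    and xs: "xs \<in> listset (map states Hs)" and ys: "ys \<in> listset (map states Hs)"
    and \<sigma>: "\<sigma> \<in> alphabet G"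
    and loc: "\<forall>i < length Hs. local_step (Hs ! i) \<sigma> (xs ! i) (ys ! i)"
  shows "path G x t y \<Longrightarrow> delete_tau t = [\<sigma>] \<Longrightarrow> path (sync_or G Hs) (x, xs) t (y, ys)"
proof (induction t arbitrary: x)
  case (Cons e t)
  then obtain z where z: "(x, e, z) \<in> transitions G" "path G z t y" by auto
  show ?case
  proof (cases e)
    case None
    with z have "((x, xs), None, (z, xs)) \<in> transitions (sync_or G Hs)"
      using sync_or_left wf_automaton_transition(1) wf xs by metis
    with None z Cons.IH Cons.prems show ?thesis by auto
  next
    case (Some a)
    with Cons.prems have t: "a = \<sigma>" "delete_tau t = []" by auto
    have "((x, xs), Some \<sigma>, (z, ys)) \<in> transitions (sync_or G Hs)"
      using z(1) Some t wf_automaton_transition [OF wf z(1)] xs ys \<sigma> loc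
      by (intro sync_or_joint) (auto simp: sync_or_sel local_step_def)
    with sync_or_path_tau [OF wf ys z(2) t(2)] Some t show ?thesis by auto
  qed
qed simp

lemma events_tau_sync_or: "events_tau G \<subseteq> events_tau (sync_or G Hs)"
  by (auto simp: events_tau_def sync_or_sel)

text \<open>Only the first coordinate is related by \<open>S\<close>; the others are copied. Equal
  alphabets ensure that \<open>A\<close> and \<open>B\<close> take part in the same joint events,
  and \<open>states\<close> makes the matching tuples states of the composition.\<close>

lemma weak_simulation_sync_or:
  assumes sim: "weak_simulation A B S" and wf: "wf_automaton B"
    and alphabet: "alphabet A = alphabet B" and states: "\<And>p q. (p, q) \<in> S \<Longrightarrow> q \<in> states B"
  shows "weak_simulation (sync_or A Hs) (sync_or B Hs) {((p, xs), (q, xs)) |p q xs. (p, q) \<in> S}"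
    (is "weak_simulation _ _ ?T")
  unfolding weak_simulation_def
proof (intro allI impI)
  fix P Q e P'
  assume "(P, Q) \<in> ?T" and tr: "(P, e, P') \<in> transitions (sync_or A Hs)"
  then obtain x xs q where P: "P = (x, xs)" "Q = (q, xs)" and xq: "(x, q) \<in> S" by blast
  have q: "q \<in> states B" using states xq .
  \<comment> \<open>Lifts a weak path of \<open>B\<close> to the composition, using the very word
    that realises it; the liftings of paths proved above serve as its last premise.\<close>
  have step: "\<exists>Q'. weak_path (sync_or B Hs) Q s Q' \<and> (P', Q') \<in> ?T"
    if "weak_path B q s q'" "(y, q') \<in> S" "P' = (y, ys)"
      "\<And>t. path B q t q' \<Longrightarrow> delete_tau t = s \<Longrightarrow> path (sync_or B Hs) (q, xs) t (q', ys)"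
    for s q' y ys
    using that events_tau_sync_or [of B Hs] lists_mono unfolding weak_path_def P by blast
  from tr [unfolded P] show "\<exists>Q'. weak_path (sync_or B Hs) Q (delete_tau [e]) Q' \<and> (P', Q') \<in> ?T"
  proof (cases rule: sync_or_transition_cases)
    case (joint \<sigma> y ys)
    show ?thesis
    proof (cases "\<sigma> \<in> alphabet B")
      case True
      with joint(6) have "(x, Some \<sigma>, y) \<in> transitions A"
        by (simp add: local_step_def alphabet)
      then obtain q' where "weak_path B q [\<sigma>] q'" "(y, q') \<in> S"
        using sim xq unfolding weak_simulation_def by fastforce
      with step sync_or_path_joint [OF wf joint(3,4) True joint(7)] joint(1,2)
      show ?thesis by auto
    next
      \<comment> \<open>The first component does not take part in \<sigma>, so \<open>q\<close>
        stays put while the others move as before; \<sigma> then belongs to the alphabet of some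
        automaton in \<open>Hs\<close>.\<close>
      case False
      with joint(6) have "y = x" by (simp add: local_step_def alphabet)
      moreover have "(Q, e, (q, ys)) \<in> transitions (sync_or B Hs)"
        using joint False q alphabet unfolding P joint(1)
        by (intro sync_or_joint) (auto simp: local_step_def sync_or_sel)
      moreover have "e \<in> events_tau (sync_or B Hs)"
        using joint alphabet by (auto simp: events_tau_def sync_or_sel)
      ultimately show ?thesis
        using weak_path_step joint(2) xq by fastforce
    qed
  next
    \<comment> \<open>\<open>B\<close> may answer with any number of \<tau>-steps, possibly
      none.\<close>
    case (left y)
    then obtain q' where "weak_path B q [] q'" "(y, q') \<in> S"
      using sim xq unfolding weak_simulation_def by fastforce
    with step sync_or_path_tau [OF wf left(3)] left(1,2) show ?thesis by auto
  next
    case (right i y)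
    then have "(Q, e, (q, xs[i := y])) \<in> transitions (sync_or B Hs)"
      using sync_or_right q unfolding P by fast
    moreover have "e \<in> events_tau (sync_or B Hs)"
      using right by (simp add: events_tau_def)
    ultimately show ?thesis
      using weak_path_step right(2) xq by fastforce
  qed
qed

text \<open>Stated as one implication but with hypotheses symmetric in \<open>A\<close> and
  \<open>B\<close>, so that exchanging them and passing to the converse of \<open>S\<close> yields
  the other implication.\<close>

lemma K_step_opaque_sync_or_weak_bisimulation:
  fixes Hs :: "('e, 'r) automaton list"
  assumes "weak_simulation A B S" "weak_simulation B A (S\<inverse>)"
    and "wf_automaton A" "wf_automaton B" and alphabet: "alphabet A = alphabet B"
    and states: "S \<subseteq> states A \<times> states B"
    and "\<And>p. p \<in> initial A \<Longrightarrow> \<exists>q \<in> initial B. (p, q) \<in> S"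
    and "\<And>q. q \<in> initial B \<Longrightarrow> \<exists>p \<in> initial A. (p, q) \<in> S"
    and secret: "\<And>p q. (p, q) \<in> S \<Longrightarrow> p \<in> secret A \<longleftrightarrow> q \<in> secret B"
    and "K_step_opaque K (sync_or A Hs)"
  shows "K_step_opaque K (sync_or B Hs)"
proof (rule K_step_opaque_weak_bisimulation)
  let ?T = "{((p, xs), (q, xs)) |p q (xs :: 'r list). (p, q) \<in> S}"
  show "weak_simulation (sync_or A Hs) (sync_or B Hs) ?T"
    using assms by (intro weak_simulation_sync_or) auto
  \<comment> \<open>The converse of the lifted relation is the lifting of the converse, so
    \<open>weak_simulation_sync_or\<close> covers both directions.\<close>
  have "?T\<inverse> = {((q, xs), (p, xs)) |q p (xs :: 'r list). (q, p) \<in> S\<inverse>}" by auto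
  moreover have "weak_simulation (sync_or B Hs) (sync_or A Hs) \<dots>"
    using assms by (intro weak_simulation_sync_or) auto
  ultimately show "weak_simulation (sync_or B Hs) (sync_or A Hs) (?T\<inverse>)" by simp
  show "alphabet (sync_or A Hs) = alphabet (sync_or B Hs)"
    by (simp add: sync_or_sel alphabet)
  show "\<exists>Q \<in> initial (sync_or B Hs). (P, Q) \<in> ?T" if "P \<in> initial (sync_or A Hs)" for P
    using that assms(7) by (fastforce simp: sync_or_sel)
  show "\<exists>P \<in> initial (sync_or A Hs). (P, Q) \<in> ?T" if "Q \<in> initial (sync_or B Hs)" for Q
    using that assms(8) by (fastforce simp: sync_or_sel)
  \<comment> \<open>A tuple is secret when some coordinate is. Related tuples agree outside the
    first coordinate, where \<open>S\<close> preserves secrecy and relates states to states.\<close>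
  show "P \<in> secret (sync_or A Hs)" if "(P, Q) \<in> ?T" "Q \<in> secret (sync_or B Hs)" for P Q
    using that states secret by (auto simp: sync_or_sel nonsecret_def)
  show "Q \<in> nonsecret (sync_or B Hs)" if "(P, Q) \<in> ?T" "P \<in> nonsecret (sync_or A Hs)" for P Q
    using that states secret by (auto simp: sync_or_sel nonsecret_def)
qed fact

section \<open>The quotient automaton\<close>

lemma wf_quotient_automaton:
  assumes "wf_automaton G" and "equiv (states G) R"
  shows "wf_automaton (quotient_automaton G R)"
proof -
  have "R \<subseteq> states G \<times> states G"
    using assms(2) by (simp add: equiv_type)
  then have "finite (states G // R)"
    using assms(1) finite_quotient unfolding wf_automaton_def by blast
  then show ?thesis
    using assms(1) unfolding wf_automaton_def quotient_automaton_def events_tau_def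
    by (auto intro: quotientI)
qed

text \<open>A transition of \<open>G\<close> is itself a witness for the transition between the
  classes of its end points.\<close>

lemma weak_simulation_quotient:
  assumes wf: "wf_automaton G" and eq: "equiv (states G) R"
  shows "weak_simulation G (quotient_automaton G R) {(x, R `` {x}) |x. x \<in> states G}"
  unfolding weak_simulation_def
proof (intro allI impI)
  fix p Q e p'
  assume "(p, Q) \<in> {(x, R `` {x}) |x. x \<in> states G}" and tr: "(p, e, p') \<in> transitions G"
  then have Q: "Q = R `` {p}" by blast
  note mem = wf_automaton_transition [OF wf tr]
  have "(Q, e, R `` {p'}) \<in> transitions (quotient_automaton G R)"
    using tr mem eq equiv_class_self [OF eq] unfolding Q quotient_automaton_def
    by (auto intro!: quotientI)
  moreover have "e \<in> events_tau (quotient_automaton G R)"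
    using mem(2) by (simp add: events_tau_def quotient_automaton_def)
  ultimately show "\<exists>Q'. weak_path (quotient_automaton G R) Q (delete_tau [e]) Q' \<and>
      (p', Q') \<in> {(x, R `` {x}) |x. x \<in> states G}"
    using weak_path_step mem(3) by fast
qed

text \<open>A transition of the quotient may start at a representative \<open>x'\<close> other than
  \<open>x\<close>. The equivalence carries its observation, a word of length at most one, over to
  \<open>x\<close>, ending in the class of \<open>y'\<close>, which is \<open>Y\<close>.\<close>

lemma weak_simulation_quotient_converse:
  assumes wf: "wf_automaton G" and R: "opaque_observation_equivalence G R"
  shows "weak_simulation (quotient_automaton G R) G ({(x, R `` {x}) |x. x \<in> states G}\<inverse>)"
  unfolding weak_simulation_def
proof (intro allI impI)
  have eq: "equiv (states G) R"
    using R unfolding opaque_observation_equivalence_def by simp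
  fix X x e Y
  assume "(X, x) \<in> {(x, R `` {x}) |x. x \<in> states G}\<inverse>"
    and tr: "(X, e, Y) \<in> transitions (quotient_automaton G R)"
  then have X: "X = R `` {x}" by blast
  from tr obtain x' y' where Y: "Y \<in> states G // R" "y' \<in> Y" and "x' \<in> X"
    and tr': "(x', e, y') \<in> transitions G"
    unfolding quotient_automaton_def by auto
  \<comment> \<open>Membership in the class gives the pair \<open>(x, x')\<close>; it is flipped
    because the move is transferred from \<open>x'\<close> to \<open>x\<close>.\<close>
  then have "(x', x) \<in> R" using X eq by (auto elim: equivE dest: symD)
  moreover have "weak_path G x' (delete_tau [e]) y'"
    using weak_path_step tr' wf_automaton_transition(2) [OF wf tr'] .
  moreover have "delete_tau [e] \<in> lists (alphabet G)"
    using wf_automaton_transition(2) [OF wf tr'] by (auto simp: events_tau_def)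
  ultimately obtain y where y: "weak_path G x (delete_tau [e]) y" "(y', y) \<in> R"
    using R unfolding opaque_observation_equivalence_def by fast
  have "Y = R `` {y'}"
    using Y eq by (metis Image_singleton_iff equiv_class_eq quotientE)
  also have "\<dots> = R `` {y}"
    using equiv_class_eq [OF eq y(2)] .
  finally have "Y = R `` {y}" .
  moreover have "y \<in> states G"
    using y(2) equiv_type [OF eq] by blast
  ultimately show "\<exists>y. weak_path G x (delete_tau [e]) y \<and>
      (Y, y) \<in> {(x, R `` {x}) |x. x \<in> states G}\<inverse>"
    using y(1) by blast
qed

section \<open>Opacity of the composed system and its abstraction\<close>

theorem theorem7:
  fixes K :: nat
    and G1 :: "('e, 'p) automaton"
    and Gs :: "('e, 'q) automaton list"
    and R :: "('p \<times> 'p) set"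
  assumes "wf_automaton G1"
    and "\<forall>G \<in> set Gs. wf_automaton G"
    and "opaque_observation_equivalence G1 R"
  shows "K_step_opaque K (sync_or G1 Gs) \<longleftrightarrow>
         K_step_opaque K (sync_or (quotient_automaton G1 R) Gs)"
proof -
  let ?S = "{(x, R `` {x}) |x. x \<in> states G1}"
  let ?Q = "quotient_automaton G1 R"
  have eq: "equiv (states G1) R"
    using assms(3) unfolding opaque_observation_equivalence_def by simp
  have wf: "wf_automaton ?Q"
    using wf_quotient_automaton assms(1) eq .
  have sub: "initial G1 \<subseteq> states G1" "secret G1 \<subseteq> states G1"
    using assms(1) by (auto simp: wf_automaton_def)
  have sim: "weak_simulation G1 ?Q ?S" "weak_simulation ?Q G1 (?S\<inverse>)"
    using weak_simulation_quotient weak_simulation_quotient_converse assms(1,3) eq by blast+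
  have alphabet: "alphabet G1 = alphabet ?Q"
    by (simp add: quotient_automaton_def)
  have states: "?S \<subseteq> states G1 \<times> states ?Q"
    by (auto simp: quotient_automaton_def intro: quotientI)
  have initial: "\<exists>Y \<in> initial ?Q. (x, Y) \<in> ?S" if "x \<in> initial G1" for x
    using that sub by (auto simp: quotient_automaton_def)
  have initial': "\<exists>x \<in> initial G1. (x, Y) \<in> ?S" if "Y \<in> initial ?Q" for Y
    using that sub by (auto simp: quotient_automaton_def)
  have secret: "x \<in> secret G1 \<longleftrightarrow> Y \<in> secret ?Q" if "(x, Y) \<in> ?S" for x Y
  proof
    assume "Y \<in> secret ?Q"
    \<comment> \<open>A secret class is presented by a secret element \<open>z\<close>, possibly
      different from \<open>x\<close>; invariance of secrecy under \<open>R\<close> transfers it to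
      \<open>x\<close>.\<close>
    with that obtain z where "z \<in> secret G1" "R `` {x} = R `` {z}" "x \<in> states G1"
      by (auto simp: quotient_automaton_def)
    then have "(z, x) \<in> R"
      using eq_equiv_class [of R z x] eq by metis
    with \<open>z \<in> secret G1\<close> assms(3) show "x \<in> secret G1"
      unfolding opaque_observation_equivalence_def by fast
  qed (use that in \<open>auto simp: quotient_automaton_def\<close>)
  show ?thesis
  proof
    assume opaque: "K_step_opaque K (sync_or G1 Gs)"
    show "K_step_opaque K (sync_or ?Q Gs)"
      by (rule K_step_opaque_sync_or_weak_bisimulation [OF sim assms(1) wf alphabet states])
        (fact initial initial' secret opaque)+
  next
    assume opaque: "K_step_opaque K (sync_or ?Q Gs)"
    show "K_step_opaque K (sync_or G1 Gs)"
    \<comment> \<open>The roles of \<open>G1\<close> and its quotient are exchanged. The simulation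
      left open by \<open>_\<close> is thus required for the double converse of
      \<open>?S\<close>.\<close>
    proof (rule K_step_opaque_sync_or_weak_bisimulation
        [OF sim(2) _ wf assms(1) alphabet [symmetric]])
      show "weak_simulation G1 ?Q ((?S\<inverse>)\<inverse>)"
        using sim(1) by simp
      show "?S\<inverse> \<subseteq> states ?Q \<times> states G1"
        using states by blast
    qed (use initial initial' secret opaque in \<open>simp_all only: converse_iff\<close>)
  qed
qed

end
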